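(* Let $U_n(132)$ be the set of $132$-avoiding permutations of $[n]$ that have a unique longest increasing subsequence, and $V_n(132)$ the set of $132$-avoiding permutations of $[n]$ that do not. Let $\mathcal{S}_n$ be the set of sequences $s_1\cdots s_n$ of positive integers with $s_i - s_{i+1}\le 1$ for all $i\in[n-1]$ and $s_n=1$; let $\mathcal{T}_n\subseteq\mathcal{S}_n$ be those sequences whose maximum value is attained at least twice, and $\mathcal{T}'_n=\mathcal{S}_n\setminus\mathcal{T}_n$. Define $f:\mathcal{T}_n\to\mathcal{T}'_n$ as follows: for $T=t_1\cdots t_n\in\mathcal{T}_n$ with maximum value $k$, let $i<j$ be the last two positions with $t_i=t_j=k$, and let $f(T)$ be obtained from $T$ by replacing $t_m$ with $t_m+1$ for every $m$ with $i\le m<j$ (all other entries unchanged). Let $R$ be the map sending a $132$-avoiding permutation $p=p_1\cdots p_n$ to $R(p)=r(p_1)\cdots r(p_n)$, where $r(p_i)$ is the maximal length of an increasing subsequence of $p$ beginning at $p_i$; $R$ is a bijection from the set of $132$-avoiding permutations of $[n]$ onto $\mathcal{S}_n$. Then $g = R^{-1}\circ f\circ R$ is an injection from $V_n(132)$ into $U_n(132)$. Consequently $|U_n(132)|\ge |V_n(132)|$.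
   Context: A permutation $p=p_1\cdots p_n$ avoids $132$ if there are no indices $a<b<c$ with $p_a<p_c<p_b$. An increasing subsequence of $p$ is a sequence of entries $p_{j_1}<\cdots<p_{j_k}$ with $j_1<\cdots<j_k$; it begins at $p_{j_1}$. A permutation has a unique longest increasing subsequence if there is an increasing subsequence strictly longer than all other increasing subsequences. *)

theory Defs
  imports "HOL-Library.Sublist" "HOL-Library.FuncSet" "HOL-Combinatorics.Multiset_Permutations"
begin

text \<open>
  Permutations of \<open>{1..n}\<close> are in one-line notation: the list \<open>p\<close> is $p_1 \cdots p_n$, and
  $p_i$ is \<open>p ! (i - 1)\<close>. As the entries are distinct, a subsequence is determined
  by its list of values, and the position where it begins by its first value.
\<close>

definition avoids_132 :: "nat list \<Rightarrow> bool" where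
  "avoids_132 p \<longleftrightarrow>
     \<not> (\<exists>a b c. a < b \<and> b < c \<and> c < length p \<and> p ! a < p ! c \<and> p ! c < p ! b)"

definition Av132 :: "nat \<Rightarrow> nat list set" where
  "Av132 n = {p \<in> permutations_of_set {1..n}. avoids_132 p}"

definition incr_subseq :: "nat list \<Rightarrow> nat list \<Rightarrow> bool" where
  "incr_subseq q p \<longleftrightarrow> subseq q p \<and> sorted_wrt (<) q"

definition has_unique_lis :: "nat list \<Rightarrow> bool" where
  "has_unique_lis p \<longleftrightarrow>
     (\<exists>q. incr_subseq q p \<and> (\<forall>q'. incr_subseq q' p \<and> q' \<noteq> q \<longrightarrow> length q' < length q))"

definition U132 :: "nat \<Rightarrow> nat list set" where
  "U132 n = {p \<in> Av132 n. has_unique_lis p}"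

definition V132 :: "nat \<Rightarrow> nat list set" where
  "V132 n = {p \<in> Av132 n. \<not> has_unique_lis p}"

text \<open>For \<open>n = 0\<close> the condition on the last entry is void, so \<open>seqS 0 = {[]}\<close>.\<close>

definition seqS :: "nat \<Rightarrow> nat list set" where
  "seqS n = {s. length s = n \<and> (\<forall>i<n. 1 \<le> s ! i) \<and>
                (\<forall>i. Suc i < n \<longrightarrow> int (s ! i) - int (s ! Suc i) \<le> 1) \<and>
                (0 < n \<longrightarrow> s ! (n - 1) = 1)}"

definition seqT :: "nat \<Rightarrow> nat list set" where
  "seqT n = {s \<in> seqS n. 2 \<le> count_list s (Max (set s))}"

definition seqT' :: "nat \<Rightarrow> nat list set" where
  "seqT' n = seqS n - seqT n"

text \<open>Meaningful only if the maximum of \<open>t\<close> is attained at least twice.\<close>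

definition raise_max :: "nat list \<Rightarrow> nat list" where
  "raise_max t =
     (let k = Max (set t);
          j = Max {m. m < length t \<and> t ! m = k};
          i = Max {m. m < j \<and> t ! m = k}
      in map (\<lambda>m. if i \<le> m \<and> m < j then t ! m + 1 else t ! m) [0..<length t])"

definition rank :: "nat list \<Rightarrow> nat \<Rightarrow> nat" where
  "rank p x = Max {length q | q. incr_subseq q p \<and> q \<noteq> [] \<and> hd q = x}"

definition rank_seq :: "nat list \<Rightarrow> nat list" where
  "rank_seq p = map (rank p) p"

definition lis_map :: "nat \<Rightarrow> nat list \<Rightarrow> nat list" where
  "lis_map n = inv_into (Av132 n) rank_seq \<circ> raise_max \<circ> rank_seq"

end

theory Submission imports Defs begin

text \<open>
  In a 132-avoiding permutation the larger entries to the right of $p_i$ increase, so the rank of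
  $p_i$ is one plus their number: the rank sequence is a Lehmer code. A permutation is determined
  by its Lehmer code, and it avoids 132 iff this code drops by at most one at each step. Moreover
  exactly one increasing subsequence of maximal length begins at each entry, so a longest
  increasing subsequence is unique as soon as the maximal rank is attained only once.
\<close>

section \<open>Lehmer codes and sequences with bounded drops\<close>

text \<open>The usual Lehmer code counts the larger later entries; the extra \<open>Suc\<close>
  counts the entry itself, turning the count into a subsequence length.\<close>

fun lehmer_code :: "nat list \<Rightarrow> nat list" where
  "lehmer_code [] = []"
| "lehmer_code (x # p) = Suc (length (filter (\<lambda>y. x < y) p)) # lehmer_code p"

text \<open>The conditions of \<open>seqS\<close> recast for list recursion: the singleton clause
  carries the condition on the last entry, and \<open>x \<le> Suc y\<close> avoids integer
  subtraction.\<close>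

fun small_descents :: "nat list \<Rightarrow> bool" where
  "small_descents [] = True"
| "small_descents [x] = (x = 1)"
| "small_descents (x # y # s) = (1 \<le> x \<and> x \<le> Suc y \<and> small_descents (y # s))"

lemma length_lehmer_code [simp]: "length (lehmer_code p) = length p"
  by (induction p) auto

lemma seqS_eq: "seqS n = {s. length s = n \<and> small_descents s}"
proof -
  have "small_descents s \<longleftrightarrow> (\<forall>i<length s. 1 \<le> s ! i) \<and>
     (\<forall>i. Suc i < length s \<longrightarrow> int (s ! i) - int (s ! Suc i) \<le> 1) \<and>
     (0 < length s \<longrightarrow> s ! (length s - 1) = 1)" for s
  proof (induction s rule: small_descents.induct)
    case (3 x y s)
    have split: "(\<forall>i. P i) \<longleftrightarrow> P 0 \<and> (\<forall>i. P (Suc i))" for P :: "nat \<Rightarrow> bool"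
      by (metis nat.exhaust)
    show ?case
      unfolding small_descents.simps 3
      \<comment> \<open>Occurrences 3 and 4 are the index quantifiers over the longer list; peeling
        off index 0 leaves the conditions for \<open>y # s\<close>.\<close>
      by (subst (3 4) split) auto
  qed (auto simp: nth_Cons')
  then show ?thesis by (auto simp: seqS_def)
qed

section \<open>Reading the pattern 132 off the Lehmer code\<close>

text \<open>A forbidden triple either starts at the new entry \<open>x\<close> or lies wholly in
  \<open>p\<close>. The first case is a condition on pairs, which \<open>sorted_wrt\<close>
  expresses.\<close>

lemma avoids_132_Cons:
  "avoids_132 (x # p) \<longleftrightarrow> avoids_132 p \<and> sorted_wrt (\<lambda>b c. \<not> (x < c \<and> c < b)) p"
proof
  assume L: "avoids_132 (x # p)"
  have "avoids_132 p"
    unfolding avoids_132_def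
  proof (intro notI, elim exE conjE)
    fix a b c assume "a < b" "b < c" "c < length p" "p ! a < p ! c" "p ! c < p ! b"
    then show False using L[unfolded avoids_132_def, simplified, rule_format, of "Suc a" "Suc b" "Suc c"]
      by simp
  qed
  moreover have "sorted_wrt (\<lambda>b c. \<not> (x < c \<and> c < b)) p"
    unfolding sorted_wrt_iff_nth_less
  proof (intro allI impI notI, elim conjE)
    fix b c assume "b < c" "c < length p" "x < p ! c" "p ! c < p ! b"
    then show False using L[unfolded avoids_132_def, simplified, rule_format, of 0 "Suc b" "Suc c"]
      by simp
  qed
  ultimately show "avoids_132 p \<and> sorted_wrt (\<lambda>b c. \<not> (x < c \<and> c < b)) p" ..
next
  assume R: "avoids_132 p \<and> sorted_wrt (\<lambda>b c. \<not> (x < c \<and> c < b)) p"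
  show "avoids_132 (x # p)"
    unfolding avoids_132_def
  proof (intro notI, elim exE conjE)
    fix a b c assume abc: "a < b" "b < c" "c < length (x # p)"
      "(x # p) ! a < (x # p) ! c" "(x # p) ! c < (x # p) ! b"
    then obtain b' c' where bc: "b = Suc b'" "c = Suc c'" by (cases b; cases c) auto
    show False
    proof (cases a)
      case 0
      then show False using R abc bc by (auto simp: sorted_wrt_iff_nth_less)
    next
      case (Suc a')
      then show False using R abc bc by (auto simp: avoids_132_def)
    qed
  qed
qed

lemma sorted_larger_if_avoids_132:
  assumes "avoids_132 (x # p)" "distinct p"
  shows "sorted_wrt (<) (filter (\<lambda>y. x < y) p)"
proof -
  have "sorted_wrt (\<lambda>b c. \<not> (x < c \<and> c < b)) p" using assms(1) by (simp add: avoids_132_Cons)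
  then show ?thesis using assms(2) by (induction p) (force simp: not_less le_less)+
qed

text \<open>If \<open>x < y\<close>, the left count exceeds the count for \<open>y\<close> by one
  for \<open>y\<close> itself and one for each \<open>z\<close> in \<open>p\<close> strictly
  between, and each such \<open>z\<close> makes \<open>x\<close>, \<open>y\<close>, \<open>z\<close>
  a 132. If \<open>y < x\<close>, both sides hold.\<close>

lemma avoids_132_Cons_Cons:
  assumes "distinct (x # y # p)" "avoids_132 (y # p)"
  shows "avoids_132 (x # y # p) \<longleftrightarrow>
    length (filter (\<lambda>z. x < z) (y # p)) \<le> Suc (length (filter (\<lambda>z. y < z) p))"
proof -
  have sorted_y: "sorted_wrt (\<lambda>b c. \<not> (y < c \<and> c < b)) p"
    using assms(2) by (simp add: avoids_132_Cons)
  show ?thesis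
  proof (cases "x < y")
    case True
    have "length (filter (\<lambda>z. x < z) p) =
        length (filter (\<lambda>z. y < z) p) + length (filter (\<lambda>z. x < z \<and> z < y) p)"
      using assms(1) True by (induction p) auto
    then have "length (filter (\<lambda>z. x < z) (y # p)) \<le> Suc (length (filter (\<lambda>z. y < z) p)) \<longleftrightarrow>
        (\<forall>z\<in>set p. \<not> (x < z \<and> z < y))"
      using True by (simp add: filter_empty_conv)
    moreover have "avoids_132 (x # y # p) \<longleftrightarrow> (\<forall>z\<in>set p. \<not> (x < z \<and> z < y))"
    proof -
      have "sorted_wrt (\<lambda>b c. \<not> (x < c \<and> c < b)) p" if "\<forall>z\<in>set p. \<not> (x < z \<and> z < y)"
      \<comment> \<open>With no value between, \<open>x < c\<close> forces \<open>y < c\<close>, so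
        a bad pair for \<open>x\<close> is already bad for \<open>y\<close>.\<close>
      proof (rule sorted_wrt_mono_rel[OF _ sorted_y])
        fix b c assume "b \<in> set p" "c \<in> set p" "\<not> (y < c \<and> c < b)"
        then show "\<not> (x < c \<and> c < b)"
          using that assms(1) by (metis distinct.simps(2) list.set_intros(2) nat_neq_iff)
      qed
      then show ?thesis using assms(2) by (subst avoids_132_Cons) auto
    qed
    ultimately show ?thesis by simp
  next
    case False
    then have "y < x" using assms(1) by auto
    have "length (filter (\<lambda>z. x < z) p) \<le> length (filter (\<lambda>z. y < z) p)"
      using \<open>y < x\<close> by (induction p) auto
    moreover have "sorted_wrt (\<lambda>b c. \<not> (x < c \<and> c < b)) p"
      using \<open>y < x\<close> by (intro sorted_wrt_mono_rel[OF _ sorted_y]) auto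
    ultimately show ?thesis using assms(2) False by (subst avoids_132_Cons) auto
  qed
qed

text \<open>Each new leading entry adds one bound, that of \<open>avoids_132_Cons_Cons\<close>; if
  \<open>y # p\<close> already contains 132, both sides fail.\<close>

lemma avoids_132_iff_small_descents:
  "distinct p \<Longrightarrow> avoids_132 p \<longleftrightarrow> small_descents (lehmer_code p)"
proof (induction p rule: induct_list012)
  case (3 x y p)
  then have IH: "avoids_132 (y # p) \<longleftrightarrow> small_descents (lehmer_code (y # p))" by simp
  show ?case
  proof (cases "avoids_132 (y # p)")
    case True
    with IH avoids_132_Cons_Cons[OF "3.prems" True] show ?thesis by simp
  next
    case False
    with IH show ?thesis by (subst avoids_132_Cons) simp
  qed
qed (simp_all add: avoids_132_def)

section \<open>Decoding Lehmer codes\<close>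

lemma inj_on_card_greater:
  fixes A :: "nat set"
  assumes "finite A"
  shows "inj_on (\<lambda>x. card {y \<in> A. x < y}) A"
proof -
  have "card {z \<in> A. y < z} < card {z \<in> A. x < z}" if "x < y" "x \<in> A" "y \<in> A" for x y
    using that assms by (intro psubset_card_mono) auto
  then show ?thesis by (metis (no_types, lifting) inj_onI less_irrefl linorder_neqE_nat)
qed

text \<open>The counts are distinct and below \<open>card A\<close>, so each possible value is
  taken.\<close>

lemma image_card_greater:
  fixes A :: "nat set"
  assumes "finite A"
  shows "(\<lambda>x. card {y \<in> A. x < y}) ` A = {..<card A}"
proof (rule card_subset_eq)
  show "(\<lambda>x. card {y \<in> A. x < y}) ` A \<subseteq> {..<card A}"
  proof (rule image_subsetI)
    fix x assume "x \<in> A"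
    then have "{y \<in> A. x < y} \<subset> A" by auto
    then show "card {y \<in> A. x < y} \<in> {..<card A}" using assms by (simp add: psubset_card_mono)
  qed
  show "card ((\<lambda>x. card {y \<in> A. x < y}) ` A) = card {..<card A}"
    using card_image[OF inj_on_card_greater[OF assms]] by simp
qed simp

text \<open>The right side depends only on the set of values, so the first code entry can be decoded
  without knowing the order of the rest.\<close>

lemma length_filter_greater:
  fixes x :: nat
  assumes "distinct (x # p)"
  shows "length (filter (\<lambda>y. x < y) p) = card {y \<in> set (x # p). x < y}"
proof -
  have "{y \<in> set (x # p). x < y} = set (filter (\<lambda>y. x < y) p)"
    by auto
  then show ?thesis using assms by (simp add: distinct_card del: set_filter)
qed

text \<open>Decoding from the left: the set of values and the first code entry fix the first entry,
  and removing it leaves the same problem for the tail.\<close>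

lemma lehmer_code_inject:
  assumes "distinct p" "distinct q" "set p = set q" "lehmer_code p = lehmer_code q"
  shows "p = q"
  using assms
proof (induction p arbitrary: q)
  case (Cons x p)
  then obtain y q' where q: "q = y # q'" by (cases q) auto
  have "card {z \<in> set q. x < z} = card {z \<in> set q. y < z}"
    using Cons.prems length_filter_greater[of x p] length_filter_greater[of y q'] by (simp add: q)
  then have "x = y"
    using inj_on_card_greater[of "set q"] Cons.prems(3) by (auto simp: inj_on_def q)
  then have "set p = set q'" using Cons.prems q by auto
  then show ?case using Cons.IH[of q'] Cons.prems q \<open>x = y\<close> by simp
qed simp

text \<open>Read from the right, the sequence starts at 1 and grows by at most one per step. This
  keeps each code entry among the attainable counts.\<close>

lemma small_descents_hd_le: "small_descents (x # s) \<Longrightarrow> x \<noteq> 0 \<and> x \<le> Suc (length s)"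
  by (induction s arbitrary: x) fastforce+

lemma small_descents_ConsD: "small_descents (x # s) \<Longrightarrow> small_descents s"
  by (cases s) auto

text \<open>An arbitrary finite \<open>A\<close> replaces the interval, since removing the first
  value need not leave an interval.\<close>

lemma lehmer_code_surj:
  assumes "small_descents s" "finite A" "card A = length s"
  shows "\<exists>p. distinct p \<and> set p = A \<and> lehmer_code p = s"
  using assms
proof (induction s arbitrary: A)
  case (Cons c s)
  have c: "c \<noteq> 0" "c - 1 < card A" using small_descents_hd_le[OF Cons.prems(1)] Cons.prems(3) by auto
  then obtain x where x: "x \<in> A" "card {y \<in> A. x < y} = c - 1"
    using image_card_greater[OF Cons.prems(2)] by (metis (no_types, lifting) imageE lessThan_iff)
  obtain p where p: "distinct p" "set p = A - {x}" "lehmer_code p = s"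
    using Cons.IH[of "A - {x}"] Cons.prems x(1) small_descents_ConsD by auto
  have "distinct (x # p)" "set (x # p) = A" using p x by auto
  moreover from this have "lehmer_code (x # p) = c # s"
    using length_filter_greater[of x p] x(2) c p(3) by simp
  ultimately show ?case by blast
qed simp

section \<open>Ranks in 132-avoiding permutations\<close>

lemma rank_Cons_neq:
  assumes "x \<noteq> z"
  shows "rank (z # p) x = rank p x"
proof -
  have "incr_subseq q (z # p) \<and> q \<noteq> [] \<and> hd q = x \<longleftrightarrow> incr_subseq q p \<and> q \<noteq> [] \<and> hd q = x" for q
    using assms by (cases q) (auto simp: incr_subseq_def)
  then show ?thesis by (simp add: rank_def)
qed

lemma incr_subseq_Cons_set:
  assumes "incr_subseq (x # q) (x # p)"
  shows "set q \<subseteq> set (filter (\<lambda>y. x < y) p)" "distinct q" "sorted q"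
proof -
  have "subseq q p" "sorted_wrt (<) q" "\<forall>y\<in>set q. x < y"
    using assms by (auto simp: incr_subseq_def)
  then show "set q \<subseteq> set (filter (\<lambda>y. x < y) p)" "distinct q" "sorted q"
    by (auto dest: list_emb_set simp: strict_sorted_iff)
qed

lemma finite_rank_set: "finite {length q | q. incr_subseq q p \<and> q \<noteq> [] \<and> hd q = x}"
  by (rule finite_subset[of _ "{..length p}"]) (auto simp: incr_subseq_def dest: list_emb_length)

lemma length_le_rank:
  assumes "incr_subseq q p" "q \<noteq> []"
  shows "length q \<le> rank p (hd q)"
  unfolding rank_def by (rule Max_ge[OF finite_rank_set]) (use assms in auto)

lemma rank_attained:
  assumes "x \<in> set p"
  obtains q where "incr_subseq q p" "q \<noteq> []" "hd q = x" "length q = rank p x"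
proof -
  have "incr_subseq [x] p" using assms by (simp add: incr_subseq_def subseq_singleton_left)
  then have "{length q | q. incr_subseq q p \<and> q \<noteq> [] \<and> hd q = x} \<noteq> {}" by force
  from Max_in[OF finite_rank_set this] show ?thesis using that unfolding rank_def by auto
qed

text \<open>An increasing subsequence from \<open>x\<close> continues only through larger later
  entries, which bounds the rank; avoidance puts all of these in increasing order, so the bound is
  attained.\<close>

lemma rank_hd:
  assumes "distinct (x # p)" "avoids_132 (x # p)"
  shows "rank (x # p) x = Suc (length (filter (\<lambda>y. x < y) p))"
proof (rule antisym)
  obtain q where q: "incr_subseq q (x # p)" "q \<noteq> []" "hd q = x" "length q = rank (x # p) x"
    using rank_attained[of x "x # p"] by auto
  then obtain q' where q': "q = x # q'" by (cases q) auto
  have "length q' = card (set q')"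
    using incr_subseq_Cons_set[of x q' p] q q' by (simp add: distinct_card)
  also have "\<dots> \<le> card (set (filter (\<lambda>y. x < y) p))"
    using incr_subseq_Cons_set[of x q' p] q q' by (intro card_mono) auto
  also have "\<dots> \<le> length (filter (\<lambda>y. x < y) p)" by (rule card_length)
  finally show "rank (x # p) x \<le> Suc (length (filter (\<lambda>y. x < y) p))" using q q' by simp
next
  have "incr_subseq (x # filter (\<lambda>y. x < y) p) (x # p)"
    using sorted_larger_if_avoids_132[OF assms(2)] assms(1) by (auto simp: incr_subseq_def)
  from length_le_rank[OF this] show "Suc (length (filter (\<lambda>y. x < y) p)) \<le> rank (x # p) x" by simp
qed

lemma rank_seq_eq_lehmer_code: "distinct p \<Longrightarrow> avoids_132 p \<Longrightarrow> rank_seq p = lehmer_code p"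
proof (induction p)
  case (Cons x p)
  have "map (rank (x # p)) p = map (rank p) p"
    using Cons.prems by (auto intro!: rank_Cons_neq)
  moreover have "rank_seq p = lehmer_code p" using Cons by (simp add: avoids_132_Cons)
  ultimately show ?case using rank_hd[OF Cons.prems] unfolding rank_seq_def by simp
qed (simp add: rank_seq_def)

section \<open>Uniqueness of longest increasing subsequences\<close>

text \<open>A tail of maximal length has as many entries as there are larger later ones, so it
  consists of all of them, and sortedness fixes their order.\<close>

lemma longest_from_unique:
  assumes "distinct p" "avoids_132 p" "incr_subseq (x # q) p" "incr_subseq (x # q') p"
    "length (x # q) = rank p x" "length (x # q') = rank p x"
  shows "q = q'"
  using assms
proof (induction p)
  case (Cons z p)
  show ?case
  proof (cases "x = z")
    case True
    have *: "set r = set (filter (\<lambda>y. x < y) p)"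
      if "incr_subseq (x # r) (x # p)" "length (x # r) = rank (x # p) x" for r
    proof (rule card_subset_eq)
      show "card (set r) = card (set (filter (\<lambda>y. x < y) p))"
        using incr_subseq_Cons_set[OF that(1)] that(2) rank_hd[of x p] Cons.prems True
        by (simp add: distinct_card del: set_filter)
    qed (use incr_subseq_Cons_set[OF that(1)] in auto)
    show ?thesis
      using *[of q] *[of q'] incr_subseq_Cons_set[of x q p] incr_subseq_Cons_set[of x q' p] Cons.prems
      by (intro sorted_distinct_set_unique) (auto simp: True)
  next
    case False
    then show ?thesis
      using Cons by (auto simp: rank_Cons_neq avoids_132_Cons incr_subseq_def)
  qed
qed (simp add: incr_subseq_def)

lemma count_list_map_ge_2:
  assumes "x \<in> set p" "y \<in> set p" "x \<noteq> y" "f x = k" "f y = k"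
  shows "2 \<le> count_list (map f p) k"
proof -
  have "{x, y} \<subseteq> set (filter (\<lambda>z. k = f z) p)" using assms by auto
  then have "card {x, y} \<le> card (set (filter (\<lambda>z. k = f z) p))" by (intro card_mono) auto
  also have "\<dots> \<le> length (filter (\<lambda>z. k = f z) p)" by (rule card_length)
  also have "\<dots> = count_list (map f p) k" by (induction p) auto
  finally show ?thesis using assms by simp
qed

text \<open>A rival at least as long as \<open>q\<close> has length \<open>k\<close> and begins at
  an entry of rank \<open>k\<close>, hence at \<open>x\<close>; then
  \<open>longest_from_unique\<close> identifies it with \<open>q\<close>.\<close>

lemma has_unique_lis_if_max_unique:
  assumes "distinct p" "avoids_132 p" "\<not> 2 \<le> count_list (rank_seq p) (Max (set (rank_seq p)))"
  shows "has_unique_lis p"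
proof (cases "p = []")
  case True
  \<comment> \<open>Here \<open>Max\<close> is applied to the empty set and says nothing; the empty
    subsequence is the only one.\<close>
  then show ?thesis by (auto simp: has_unique_lis_def incr_subseq_def)
next
  case False
  define k where "k = Max (set (rank_seq p))"
  have le: "rank p x \<le> k" if "x \<in> set p" for x
    using that by (auto simp: k_def rank_seq_def)
  have "k \<in> set (rank_seq p)" unfolding k_def using False by (intro Max_in) (auto simp: rank_seq_def)
  then obtain x where x: "x \<in> set p" "rank p x = k" by (auto simp: rank_seq_def)
  then obtain q where q: "incr_subseq q p" "q \<noteq> []" "hd q = x" "length q = k"
    using rank_attained by metis
  have "length r < length q" if r: "incr_subseq r p" "r \<noteq> q" for r
  proof (rule ccontr)
    assume len: "\<not> length r < length q"
    then have "r \<noteq> []" using q by auto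
    then have hd: "hd r \<in> set p" using r list_emb_set[of "(=)" r p "hd r"] by (auto simp: incr_subseq_def)
    then have eq: "length r = k" "rank p (hd r) = k"
      using length_le_rank[OF r(1) \<open>r \<noteq> []\<close>] le[of "hd r"] len q by auto
    then have "hd r = x"
      using count_list_map_ge_2[of "hd r" p x "rank p" k] hd x assms(3) by (auto simp: k_def rank_seq_def)
    then have "tl r = tl q"
      using longest_from_unique[OF assms(1,2), of x "tl r" "tl q"] r q x eq \<open>r \<noteq> []\<close>
      by (auto simp: neq_Nil_conv)
    then show False using r q \<open>hd r = x\<close> \<open>r \<noteq> []\<close> by (auto simp: neq_Nil_conv)
  qed
  with q show ?thesis by (auto simp: has_unique_lis_def)
qed

section \<open>The bijection given by rank sequences\<close>

lemma Av132_iff: "p \<in> Av132 n \<longleftrightarrow> distinct p \<and> set p = {1..n} \<and> avoids_132 p"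
  by (auto simp: Av132_def permutations_of_set_def)

lemma length_Av132: "p \<in> Av132 n \<Longrightarrow> length p = n"
  by (metis Av132_iff card_atLeastAtMost diff_Suc_1 distinct_card)

lemma bij_betw_rank_seq: "bij_betw rank_seq (Av132 n) (seqS n)"
proof (rule bij_betw_imageI)
  show "inj_on rank_seq (Av132 n)"
    by (rule inj_onI) (metis Av132_iff rank_seq_eq_lehmer_code lehmer_code_inject)
  show "rank_seq ` Av132 n = seqS n"
  proof (intro subset_antisym subsetI)
    fix s assume "s \<in> rank_seq ` Av132 n"
    then obtain p where p: "p \<in> Av132 n" "s = rank_seq p" by blast
    then have "s = lehmer_code p" by (auto simp: Av132_iff rank_seq_eq_lehmer_code)
    then show "s \<in> seqS n"
      using p(1) length_Av132[OF p(1)] avoids_132_iff_small_descents[of p]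
      by (auto simp: seqS_eq Av132_iff)
  next
    fix s assume "s \<in> seqS n"
    then have s: "length s = n" "small_descents s" by (auto simp: seqS_eq)
    then obtain p where p: "distinct p" "set p = {1..n}" "lehmer_code p = s"
      using lehmer_code_surj[of s "{1..n}"] by auto
    then have "p \<in> Av132 n" using s avoids_132_iff_small_descents[of p] by (simp add: Av132_iff)
    moreover have "rank_seq p = s"
      using p s avoids_132_iff_small_descents[of p] by (simp add: rank_seq_eq_lehmer_code)
    ultimately show "s \<in> rank_seq ` Av132 n" by blast
  qed
qed

section \<open>Raising a repeated maximum\<close>

lemma two_le_count_listD:
  assumes "2 \<le> count_list s k"
  obtains a b where "a < b" "b < length s" "s ! a = k" "s ! b = k"
proof -
  have "k \<in> set s" using assms by (metis count_notin not_numeral_le_zero)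
  then obtain us vs where s: "s = us @ k # vs" "k \<notin> set us" by (meson split_list_first)
  then have "k \<in> set vs" using assms by (cases "k \<in> set vs") auto
  then obtain b where "b < length vs" "vs ! b = k" by (auto simp: in_set_conv_nth)
  then show ?thesis using that[of "length us" "Suc (length us + b)"] s by (auto simp: nth_append)
qed

text \<open>A maximum attained twice makes both position sets in \<open>raise_max\<close> nonempty,
  so both uses of \<open>Max\<close> there return genuine positions.\<close>

lemma raise_max_nth:
  assumes "2 \<le> count_list t (Max (set t))"
  obtains i j where "i < j" "j < length t" "t ! i = Max (set t)" "t ! j = Max (set t)"
    "\<And>m. i < m \<Longrightarrow> m < length t \<Longrightarrow> m \<noteq> j \<Longrightarrow> t ! m < Max (set t)"
    "\<And>m. m < length t \<Longrightarrow> raise_max t ! m = (if i \<le> m \<and> m < j then t ! m + 1 else t ! m)"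
proof -
  define k where "k = Max (set t)"
  obtain a b where ab: "a < b" "b < length t" "t ! a = k" "t ! b = k"
    using two_le_count_listD assms k_def by metis
  define J where "J = {m. m < length t \<and> t ! m = k}"
  define j where "j = Max J"
  define I where "I = {m. m < j \<and> t ! m = k}"
  define i where "i = Max I"
  have J: "finite J" "a \<in> J" "b \<in> J" using ab by (auto simp: J_def)
  have j: "j \<in> J" "\<And>m. m \<in> J \<Longrightarrow> m \<le> j"
    unfolding j_def using J by (auto intro!: Max_in Max_ge)
  have I: "finite I" "a \<in> I" using ab j(2)[OF J(3)] by (auto simp: I_def)
  have i: "i \<in> I" "\<And>m. m \<in> I \<Longrightarrow> m \<le> i"
    unfolding i_def using I by (auto intro!: Max_in Max_ge)
  have "t ! m < k" if "i < m" "m < length t" "m \<noteq> j" for m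
  proof -
    have "t ! m \<le> k" using that by (auto simp: k_def)
    moreover have "t ! m \<noteq> k" using that i(2)[of m] j(2)[of m] by (auto simp: I_def J_def)
    ultimately show ?thesis by simp
  qed
  moreover have "raise_max t ! m = (if i \<le> m \<and> m < j then t ! m + 1 else t ! m)" if "m < length t" for m
    using that by (simp add: raise_max_def Let_def i_def I_def j_def J_def k_def)
  ultimately show ?thesis using that[of i j] i(1) j(1) by (auto simp: I_def J_def k_def)
qed

lemma length_raise_max [simp]: "length (raise_max t) = length t"
  by (simp add: raise_max_def Let_def)

text \<open>Entries strictly between \<open>i\<close> and \<open>j\<close> lie below the old
  maximum, so raising them gives at most that value: the new maximum occurs at \<open>i\<close>
  alone. Position \<open>j\<close> keeps the old maximum, and no later entry reaches it.\<close>

lemma raise_max_Max: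
  assumes "2 \<le> count_list t (Max (set t))"
  obtains i j where "i < j" "j < length t"
    "Max (set (raise_max t)) = Max (set t) + 1"
    "\<And>m. m < length t \<Longrightarrow> raise_max t ! m = Max (set t) + 1 \<longleftrightarrow> m = i"
    "raise_max t ! j = Max (set t)"
    "\<And>m. j < m \<Longrightarrow> m < length t \<Longrightarrow> raise_max t ! m < Max (set t)"
    "\<And>m. m < length t \<Longrightarrow> raise_max t ! m = (if i \<le> m \<and> m < j then t ! m + 1 else t ! m)"
proof -
  define k where "k = Max (set t)"
  have le: "t ! m \<le> k" if "m < length t" for m using that by (auto simp: k_def)
  obtain i j where ij: "i < j" "j < length t" "t ! i = k" "t ! j = k"
    "\<And>m. i < m \<Longrightarrow> m < length t \<Longrightarrow> m \<noteq> j \<Longrightarrow> t ! m < k"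
    "\<And>m. m < length t \<Longrightarrow> raise_max t ! m = (if i \<le> m \<and> m < j then t ! m + 1 else t ! m)"
    by (rule raise_max_nth[OF assms, folded k_def]) (erule that; blast)
  have iff: "raise_max t ! m = k + 1 \<longleftrightarrow> m = i" if "m < length t" for m
    using ij(6)[OF that] le[OF that] ij(1-4) ij(5)[of m] that by (cases "m = i") (auto split: if_splits)
  have "Max (set (raise_max t)) = k + 1"
  proof (rule Max_eqI)
    show "k + 1 \<in> set (raise_max t)"
      using iff[of i] ij(1,2) by (metis length_raise_max nth_mem order_less_trans)
    show "y \<le> k + 1" if y: "y \<in> set (raise_max t)" for y
    proof -
      obtain m where "m < length t" "y = raise_max t ! m" using y by (metis in_set_conv_nth length_raise_max)
      then show ?thesis using ij(6)[of m] le[of m] by auto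
    qed
  qed simp
  then show ?thesis
    using that[of i j] iff ij by (auto simp: k_def)
qed

lemma raise_max_in_seqT':
  assumes "t \<in> seqT n"
  shows "raise_max t \<in> seqT' n"
proof -
  have t: "t \<in> seqS n" and c: "2 \<le> count_list t (Max (set t))" using assms by (auto simp: seqT_def)
  define k where "k = Max (set t)"
  have len: "length t = n" using t by (simp add: seqS_def)
  have le: "t ! m \<le> k" if "m < n" for m using that len by (auto simp: k_def)
  obtain i j where ij: "i < j" "j < n"
    "Max (set (raise_max t)) = k + 1"
    "\<And>m. m < n \<Longrightarrow> raise_max t ! m = k + 1 \<longleftrightarrow> m = i"
    "raise_max t ! j = k"
    "\<And>m. m < n \<Longrightarrow> raise_max t ! m = (if i \<le> m \<and> m < j then t ! m + 1 else t ! m)"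
    by (rule raise_max_Max[OF c, folded k_def, unfolded len]) (erule that; blast)
  have "raise_max t \<in> seqS n"
    unfolding seqS_def
  proof (intro CollectI conjI allI impI)
    show "length (raise_max t) = n" by (simp add: len)
    show "1 \<le> raise_max t ! m" if "m < n" for m using that t ij(6)[of m] by (auto simp: seqS_def)
    \<comment> \<open>The window stops before \<open>j \<le> n - 1\<close>, so the last entry is
      untouched.\<close>
    show "raise_max t ! (n - 1) = 1" if "0 < n"
      using that t ij(6)[of "n - 1"] ij(2) by (auto simp: seqS_def)
    show "int (raise_max t ! m) - int (raise_max t ! Suc m) \<le> 1" if m: "Suc m < n" for m
    proof (cases "Suc m = j")
      \<comment> \<open>The only place where a drop grows: the left entry is raised, the right one
        is not. As the right one is \<open>k\<close>, the drop is still at most one.\<close>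
      case True
      then show ?thesis using ij(5) ij(6)[of m] le[of m] m by auto
    next
      case False
      have "int (t ! m) - int (t ! Suc m) \<le> 1" using t m by (auto simp: seqS_def)
      then show ?thesis using ij(6)[of m] ij(6)[of "Suc m"] m False by auto
    qed
  qed
  moreover have "\<not> 2 \<le> count_list (raise_max t) (k + 1)"
  proof
    assume "2 \<le> count_list (raise_max t) (k + 1)"
    then obtain a b where "a < b" "b < n" "raise_max t ! a = k + 1" "raise_max t ! b = k + 1"
      using two_le_count_listD by (metis len length_raise_max)
    then show False using ij(4)[of a] ij(4)[of b] by simp
  qed
  ultimately show ?thesis using ij(3) by (simp add: seqT'_def seqT_def)
qed

text \<open>In the image, the maximum sits only at \<open>i\<close>, and \<open>j\<close> is the last position of the
  maximum minus one; so the raised window, hence the original sequence, can be recovered.\<close>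

lemma inj_on_raise_max: "inj_on raise_max (seqT n)"
proof (rule inj_onI)
  fix t t' assume T: "t \<in> seqT n" "t' \<in> seqT n" and eq: "raise_max t = raise_max t'"
  then have c: "2 \<le> count_list t (Max (set t))" "2 \<le> count_list t' (Max (set t'))"
    and len: "length t = n" "length t' = n" by (auto simp: seqT_def seqS_def)
  let ?r = "raise_max t"
  obtain i j where ij: "i < j" "j < n" "Max (set ?r) = Max (set t) + 1"
    "\<And>m. m < n \<Longrightarrow> ?r ! m = Max (set t) + 1 \<longleftrightarrow> m = i"
    "?r ! j = Max (set t)" "\<And>m. j < m \<Longrightarrow> m < n \<Longrightarrow> ?r ! m < Max (set t)"
    "\<And>m. m < n \<Longrightarrow> ?r ! m = (if i \<le> m \<and> m < j then t ! m + 1 else t ! m)"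
    by (rule raise_max_Max[OF c(1), unfolded len]) (erule that; blast)
  obtain i' j' where ij': "i' < j'" "j' < n" "Max (set ?r) = Max (set t') + 1"
    "\<And>m. m < n \<Longrightarrow> ?r ! m = Max (set t') + 1 \<longleftrightarrow> m = i'"
    "?r ! j' = Max (set t')" "\<And>m. j' < m \<Longrightarrow> m < n \<Longrightarrow> ?r ! m < Max (set t')"
    "\<And>m. m < n \<Longrightarrow> ?r ! m = (if i' \<le> m \<and> m < j' then t' ! m + 1 else t' ! m)"
    by (rule raise_max_Max[OF c(2), unfolded len, folded eq]) (erule that; blast)
  have k: "Max (set t) = Max (set t')" using ij(3) ij'(3) by simp
  have "i = i'" using ij(4)[of i] ij'(4)[of i] ij(1,2) k by simp
  \<comment> \<open>If they differed, the larger would be a later position with the same value,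
    against the strict bound.\<close>
  moreover have "j = j'"
    using ij(6)[of j'] ij'(6)[of j] ij(2,5) ij'(2,5) k by (cases j j' rule: linorder_cases) auto
  ultimately show "t = t'"
    using ij(7) ij'(7) len by (intro nth_equalityI) (auto, metis add_right_cancel)
qed

section \<open>Back to permutations\<close>

text \<open>Serves both ends: its contrapositive sends \<open>V132\<close> into \<open>seqT\<close>,
  and applied to the images it places them in \<open>U132\<close>.\<close>

lemma has_unique_lis_if_notin_seqT:
  assumes "p \<in> Av132 n" "rank_seq p \<notin> seqT n"
  shows "has_unique_lis p"
  using assms bij_betwE[OF bij_betw_rank_seq] has_unique_lis_if_max_unique[of p]
  by (auto simp: seqT_def Av132_iff)

text \<open>The conjuncts on \<open>rank_seq\<close> and \<open>raise_max\<close> make the composite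
  meaningful, since \<open>inv_into\<close> inverts \<open>rank_seq\<close> only on its
  image.\<close>

theorem theorem1:
  fixes n :: nat
  shows "bij_betw rank_seq (Av132 n) (seqS n)
    \<and> rank_seq ` V132 n \<subseteq> seqT n
    \<and> raise_max \<in> seqT n \<rightarrow> seqT' n
    \<and> inj_on (lis_map n) (V132 n)
    \<and> lis_map n ` V132 n \<subseteq> U132 n
    \<and> card (U132 n) \<ge> card (V132 n)"
proof -
  have VT: "rank_seq ` V132 n \<subseteq> seqT n"
    using has_unique_lis_if_notin_seqT by (auto simp: V132_def)
  have TT: "raise_max \<in> seqT n \<rightarrow> seqT' n" using raise_max_in_seqT' by blast
  have T'S: "seqT' n \<subseteq> rank_seq ` Av132 n"
    using bij_betw_rank_seq[of n] by (auto simp: seqT'_def bij_betw_def)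
  have inj: "inj_on (lis_map n) (V132 n)"
    unfolding lis_map_def comp_assoc
  proof (intro comp_inj_on)
    show "inj_on rank_seq (V132 n)"
      using bij_betw_rank_seq[of n] by (auto simp: bij_betw_def V132_def intro: inj_on_subset)
    show "inj_on raise_max (rank_seq ` V132 n)"
      using inj_on_raise_max VT by (rule inj_on_subset)
    \<comment> \<open>The raised sequences lie in the image of \<open>rank_seq\<close>, where
      \<open>inv_into\<close> is injective.\<close>
    show "inj_on (inv_into (Av132 n) rank_seq) ((raise_max \<circ> rank_seq) ` V132 n)"
      using VT TT T'S by (intro inj_on_inv_into) fastforce
  qed
  have img: "lis_map n ` V132 n \<subseteq> U132 n"
  proof (rule image_subsetI)
    fix p assume "p \<in> V132 n"
    then have r: "raise_max (rank_seq p) \<in> seqT' n" using VT TT by blast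
    then have "raise_max (rank_seq p) \<in> rank_seq ` Av132 n" using T'S by blast
    then have "lis_map n p \<in> Av132 n" "rank_seq (lis_map n p) = raise_max (rank_seq p)"
      by (simp_all add: lis_map_def inv_into_into f_inv_into_f)
    then show "lis_map n p \<in> U132 n"
      using r has_unique_lis_if_notin_seqT[of "lis_map n p" n] by (simp add: U132_def seqT'_def)
  qed
  have "finite (U132 n)" by (simp add: U132_def Av132_def)
  then have "card (V132 n) \<le> card (U132 n)" using inj img by (rule card_inj_on_le[rotated 2])
  then show ?thesis using bij_betw_rank_seq VT TT inj img by blast
qed

end
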